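(* Let $\chi$ be a non-principal Dirichlet character of modulus $k$. Let $(r_n)_{n\ge3}$ be independent uniform random variables on $[0,1]$ and let $\mathbb{P}'=\{n\ge3: r_n\le 1/\log n\}=\{p'_1<p'_2<\cdots\}$. For each realization define $$L'(s,\chi)=\prod_{n=1}^{\infty}\Bigl(1-\frac{\chi(p'_n)}{(p'_n)^{s}}\Bigr)^{-1}.$$ Then with probability equal to $1$, the function $L'(s,\chi)$ has no zeros with $\Re(s)>1/2+\epsilon$, for any $\epsilon>0$.
   Context: This is a variant of Cramér's random model for the primes: each integer $n\ge3$ is a "pseudo-prime" independently with probability $1/\log n$; $L'$ is the random analogue of the Euler product of the Dirichlet $L$-function, defined in the region by its Euler product. *)

theory Defs
  imports "HOL-Probability.Probability"
begin

text \<open>A Dirichlet character modulo \<open>k\<close>, viewed as usual as a function on the natural numbers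
  that vanishes off the residues coprime to \<open>k\<close>. Multiplicativity and \<open>chi 1 \<noteq> 0\<close> give \<open>chi 1 = 1\<close>.\<close>

definition dirichlet_character :: "nat \<Rightarrow> (nat \<Rightarrow> complex) \<Rightarrow> bool" where
  "dirichlet_character k chi \<longleftrightarrow>
     k > 0 \<and>
     (\<forall>m n. chi (m * n) = chi m * chi n) \<and>
     (\<forall>n. chi (n + k) = chi n) \<and>
     (\<forall>n. chi n \<noteq> 0 \<longleftrightarrow> coprime n k)"

definition principal_character :: "nat \<Rightarrow> nat \<Rightarrow> complex" where
  "principal_character k n = (if coprime n k then 1 else 0)"

definition pseudo_primes :: "(nat \<Rightarrow> 'a \<Rightarrow> real) \<Rightarrow> 'a \<Rightarrow> nat set" where
  "pseudo_primes r \<omega> = {n. n \<ge> 3 \<and> r n \<omega> \<le> 1 / ln (real n)}"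

text \<open>The factors are taken in increasing order of the pseudo-primes, since for \<open>Re s \<le> 1\<close> the
  product need not converge absolutely. \<^const>\<open>enumerate\<close> counts from 0, and is only meaningful
  for infinite sets; the set of pseudo-primes is infinite almost surely.\<close>

definition euler_factor :: "(nat \<Rightarrow> complex) \<Rightarrow> nat set \<Rightarrow> complex \<Rightarrow> nat \<Rightarrow> complex" where
  "euler_factor chi P s n =
     inverse (1 - chi (enumerate P n) / of_nat (enumerate P n) powr s)"

text \<open>The value is only meaningful where \<^const>\<open>convergent_prod\<close> holds of the factors.\<close>

definition random_L :: "(nat \<Rightarrow> complex) \<Rightarrow> nat set \<Rightarrow> complex \<Rightarrow> complex" where
  "random_L chi P s = (\<Prod>n. euler_factor chi P s n)"

end

theory Submission
  imports Defs "HOL-Real_Asymp.Real_Asymp" "HOL-Number_Theory.Cong"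
begin

text \<open>
  By Hoeffding's inequality and the Borel--Cantelli lemma, almost surely the sums
  \<open>\<Sum>n<N. c n * (1\<^sub>P n - 1 / ln n)\<close> over the random set \<open>P\<close> are \<open>O(N powr (1/2 + \<delta>))\<close> for bounded
  real \<open>c\<close>. Taking \<open>c = Re chi\<close> and \<open>c = Im chi\<close>, and using that \<open>\<Sum>n. chi n / ln n\<close> converges,
  the character sums over \<open>P\<close> are \<open>O(N powr (1/2 + \<delta>))\<close>, so partial summation gives convergence of
  \<open>\<Sum>p\<in>P. chi p / p powr s\<close> for \<open>Re s > 1/2\<close>. There \<open>\<Sum>p\<in>P. \<bar>chi p / p powr s\<bar>\<^sup>2\<close> converges as
  well, so the sum of the logarithms of the Euler factors converges and the product is nonzero.
  Taking \<open>c = 1\<close> shows that \<open>P\<close> is infinite, so that its enumeration is meaningful.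
\<close>

section \<open>Summation by parts and Dirichlet series\<close>

text \<open>Abel summation: with \<open>A\<close> the partial sums of \<open>a\<close>, the term
  \<open>a n * g n\<close> splits into \<open>A (Suc n) * (g n - g (Suc n))\<close> plus a
  telescoping difference of \<open>A n * g n\<close>. The assumptions make both parts
  summable.\<close>

lemma summable_by_parts:
  fixes a g :: "nat \<Rightarrow> 'a::{real_normed_field,banach}"
  assumes "summable (\<lambda>n. norm ((\<Sum>i<Suc n. a i) * (g n - g (Suc n))))"
    and "(\<lambda>n. (\<Sum>i<n. a i) * g n) \<longlonglongrightarrow> 0"
  shows "summable (\<lambda>n. a n * g n)"
proof -
  define A where "A n = (\<Sum>i<n. a i)" for n
  have "summable (\<lambda>n. A (Suc n) * (g n - g (Suc n)))"
    using assms(1) unfolding A_def by (rule summable_norm_cancel)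
  moreover have "summable (\<lambda>n. A (Suc n) * g (Suc n) - A n * g n)"
    using telescope_summable[OF assms(2)] by (simp only: A_def)
  ultimately have "summable (\<lambda>n. A (Suc n) * (g n - g (Suc n)) + (A (Suc n) * g (Suc n) - A n * g n))"
    by (rule summable_add)
  moreover have "A (Suc n) * (g n - g (Suc n)) + (A (Suc n) * g (Suc n) - A n * g n) = a n * g n" for n
    by (simp add: A_def algebra_simps)
  ultimately show ?thesis
    by simp
qed

text \<open>For decreasing \<open>g\<close> the differences \<open>g n - g (Suc n)\<close> are
  nonnegative and telescope, so they dominate the terms left after summation by parts; the boundary
  term is bounded times null.\<close>

lemma Dirichlet_test:
  fixes a :: "nat \<Rightarrow> 'a::{real_normed_field,banach}" and g :: "nat \<Rightarrow> real"
  assumes bound: "\<And>n. norm (\<Sum>i<n. a i) \<le> C" and "decseq g" and "g \<longlonglongrightarrow> 0"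
  shows "summable (\<lambda>n. a n * of_real (g n))"
proof (rule summable_by_parts)
  have sum: "summable (\<lambda>n. C * (g n - g (Suc n)))"
    by (intro summable_mult telescope_summable'[OF assms(3)])
  have le: "norm ((\<Sum>i<Suc n. a i) * (of_real (g n) - of_real (g (Suc n)))) \<le> C * (g n - g (Suc n))" for n
  proof -
    have "norm (of_real (g n) - of_real (g (Suc n)) :: 'a) = g n - g (Suc n)"
      using decseq_SucD[OF \<open>decseq g\<close>, of n] by (simp del: of_real_diff add: of_real_diff[symmetric])
    then show ?thesis
      using mult_right_mono[OF bound[of "Suc n"], of "g n - g (Suc n)"] decseq_SucD[OF \<open>decseq g\<close>, of n]
      by (simp add: norm_mult)
  qed
  show "summable (\<lambda>n. norm ((\<Sum>i<Suc n. a i) * (of_real (g n) - of_real (g (Suc n)))))"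
    by (rule summable_comparison_test'[OF sum, of 0]) (simp only: real_norm_def abs_norm_cancel le)
next
  have "(\<lambda>n. of_real (g n) :: 'a) \<longlonglongrightarrow> 0"
    using tendsto_of_real[OF assms(3), where 'a = 'a] by simp
  moreover have "Bfun (\<lambda>n. \<Sum>i<n. a i) sequentially"
    using bound by (intro BfunI[of _ C]) simp
  ultimately show "(\<lambda>n. (\<Sum>i<n. a i) * of_real (g n)) \<longlonglongrightarrow> 0"
    using bounded_bilinear.Bfun_prod_Zfun[OF bounded_bilinear_mult, of "\<lambda>n. \<Sum>i<n. a i" sequentially "\<lambda>n. of_real (g n)"]
    by (simp add: tendsto_Zfun_iff)
qed

text \<open>The mean value inequality on the segment from \<open>n\<close> to \<open>n + 1\<close>:
  the derivative of \<open>z powr (-s)\<close> has modulus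
  \<open>norm s * x powr (- Re s - 1)\<close> at a real point \<open>x\<close>, which is largest at
  the left end.\<close>

lemma norm_powr_diff_le:
  fixes s :: complex
  assumes "n \<ge> 1" "Re s > 0"
  shows "norm (of_nat n powr (-s) - of_nat (Suc n) powr (-s)) \<le> norm s * real n powr (- Re s - 1)"
proof -
  define S where "S = closed_segment (of_real (real n) :: complex) (of_real (real (Suc n)))"
  have pos: "\<exists>x. z = of_real x \<and> real n \<le> x" if "z \<in> S" for z
    using that unfolding S_def closed_segment_of_real closed_segment_eq_real_ivl by auto
  have "norm (of_real (real n) powr (-s) - of_real (real (Suc n)) powr (-s))
      \<le> norm s * real n powr (- Re s - 1) * norm (of_real (real n) - of_real (real (Suc n)) :: complex)"
  proof (rule field_differentiable_bound)
    show "convex S"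
      by (simp add: S_def)
    fix z assume "z \<in> S"
    then obtain x where x: "z = of_real x" "real n \<le> x"
      using pos by blast
    with assms have "x > 0" by simp
    with x have "z \<notin> \<real>\<^sub>\<le>\<^sub>0"
      by simp
    then show "((\<lambda>z. z powr (-s)) has_field_derivative (- s * z powr (- s - 1))) (at z within S)"
      by (rule has_field_derivative_at_within[OF has_field_derivative_powr])
    show "norm (- s * z powr (- s - 1)) \<le> norm s * real n powr (- Re s - 1)"
      using x assms \<open>x > 0\<close>
      by (auto simp: norm_mult norm_powr_real_powr intro!: mult_left_mono powr_mono2')
  qed (auto simp: S_def)
  also have "norm (of_real (real n) - of_real (real (Suc n)) :: complex) = 1"
    by (simp add: norm_minus_commute)
  finally show ?thesis
    by simp
qed

text \<open>Summation by parts leaves terms of order \<open>n powr (\<theta> - Re s - 1)\<close>,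
  with exponent below -1, and a boundary term of order \<open>n powr (\<theta> - Re s)\<close>,
  which tends to 0.\<close>

lemma summable_dirichlet_series:
  fixes a :: "nat \<Rightarrow> complex"
  assumes A: "(\<lambda>N. norm (\<Sum>n<N. a n)) \<in> O(\<lambda>N. real N powr \<theta>)" and \<theta>: "0 \<le> \<theta>" "\<theta> < Re s"
  shows "summable (\<lambda>n. a n / of_nat n powr s)"
proof -
  let ?g = "\<lambda>n. of_nat n powr (-s) :: complex"
  have "summable (\<lambda>n. a n * ?g n)"
  proof (rule summable_by_parts)
    have "(\<lambda>n. norm (\<Sum>i<Suc n. a i)) \<in> O(\<lambda>n. real (Suc n) powr \<theta>)"
      by (rule landau_o.big.compose[OF A filterlim_Suc])
    also have "(\<lambda>n. real (Suc n) powr \<theta>) \<in> O(\<lambda>n. real n powr \<theta>)"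
      by real_asymp
    finally have 1: "(\<lambda>n. norm (\<Sum>i<Suc n. a i)) \<in> O(\<lambda>n. real n powr \<theta>)" .
    have 2: "(\<lambda>n. norm (?g n - ?g (Suc n))) \<in> O(\<lambda>n. real n powr (- Re s - 1))"
      using norm_powr_diff_le[of _ s] \<theta>
      by (intro bigoI[where c = "norm s"] eventually_mono[OF eventually_ge_at_top[of 1]]) auto
    have "(\<lambda>n. norm ((\<Sum>i<Suc n. a i) * (?g n - ?g (Suc n))))
        \<in> O(\<lambda>n. real n powr \<theta> * real n powr (- Re s - 1))"
      unfolding norm_mult by (rule landau_o.big.mult[OF 1 2])
    then have "(\<lambda>n. norm ((\<Sum>i<Suc n. a i) * (?g n - ?g (Suc n)))) \<in> O(\<lambda>n. real n powr (\<theta> + (- Re s - 1)))"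
      unfolding powr_add .
    then show "summable (\<lambda>n. norm ((\<Sum>i<Suc n. a i) * (?g n - ?g (Suc n))))"
      by (rule summable_comparison_test_bigo[rotated]) (use \<theta> in \<open>simp add: summable_real_powr_iff\<close>)
  next
    have "(\<lambda>n. norm (?g n)) \<in> O(\<lambda>n. real n powr (- Re s))"
      by (intro bigoI[where c = 1]) (simp add: norm_powr_real_powr)
    from landau_o.big.mult[OF A this]
    have "(\<lambda>n. norm ((\<Sum>i<n. a i) * ?g n)) \<in> O(\<lambda>n. real n powr (\<theta> + (- Re s)))"
      unfolding norm_mult powr_add .
    also have "(\<lambda>n. real n powr (\<theta> + (- Re s))) \<in> o(\<lambda>_. 1)"
      using \<theta> by real_asymp
    finally have "(\<lambda>n. norm ((\<Sum>i<n. a i) * ?g n)) \<longlonglongrightarrow> 0"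
      using smalloD_tendsto by fastforce
    then show "(\<lambda>n. (\<Sum>i<n. a i) * ?g n) \<longlonglongrightarrow> 0"
      by (rule tendsto_norm_zero_cancel)
  qed
  then show ?thesis
    by (simp add: powr_minus field_simps)
qed

section \<open>Conditionally convergent infinite products\<close>

text \<open>The logarithm of a factor is \<open>w n\<close> plus an error of order
  \<open>(norm (w n))\<^sup>2\<close>. The bound \<open>q\<close> makes the constant in this error
  uniform, so absolute convergence is asked of the squares only and \<open>w\<close> itself may
  converge conditionally.\<close>

lemma convergent_prod_inverse_one_minus:
  fixes w :: "nat \<Rightarrow> complex"
  assumes "summable w" "summable (\<lambda>n. (norm (w n))\<^sup>2)" "q < 1" "\<And>n. norm (w n) \<le> q"
  shows "convergent_prod (\<lambda>n. inverse (1 - w n))"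
proof -
  have w: "norm (w n) < 1" for n
    using assms(3) assms(4)[of n] by linarith
  then have nz: "inverse (1 - w n) \<noteq> 0" for n
    by (metis eq_iff_diff_eq_0 inverse_nonzero_iff_nonzero less_irrefl norm_one)
  have Ln: "Ln (inverse (1 - w n)) = - (Ln (1 - w n))" for n
  proof (rule Ln_inverse)
    have "Re (w n) < 1"
      using w[of n] complex_Re_le_cmod[of "w n"] by linarith
    then show "1 - w n \<notin> \<real>\<^sub>\<le>\<^sub>0"
      by (auto simp: complex_nonpos_Reals_iff)
  qed
  have "summable (\<lambda>n. Ln (1 - w n) + w n)"
  proof (rule summable_comparison_test'[where N = 0])
    show "summable (\<lambda>n. (norm (w n))\<^sup>2 / (1 - q))"
      using assms(2) by (rule summable_divide)
    fix n
    have "norm (Ln (1 + - w n) - - w n) \<le> (norm (- w n))\<^sup>2 / (1 - norm (- w n))"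
      by (rule Ln_approx_linear) (simp add: w)
    also have "\<dots> \<le> (norm (w n))\<^sup>2 / (1 - q)"
      using assms(3) assms(4)[of n] w[of n] by (simp add: frac_le)
    finally show "norm (Ln (1 - w n) + w n) \<le> (norm (w n))\<^sup>2 / (1 - q)"
      by simp
  qed
  from summable_diff[OF assms(1) this] have "summable (\<lambda>n. - Ln (1 - w n))"
    by simp
  then show ?thesis
    by (subst convergent_prod_iff_summable_complex[OF nz]) (simp add: Ln)
qed

section \<open>Dirichlet characters and their partial sums\<close>

lemma dirichlet_character_mod:
  assumes "dirichlet_character k chi"
  shows "chi (n mod k) = chi n"
proof -
  have "chi (m + j * k) = chi m" for m j
  proof (induction j)
    case (Suc j)
    have "chi (m + Suc j * k) = chi ((m + j * k) + k)"
      by (simp add: algebra_simps)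
    with Suc assms show ?case
      by (simp add: dirichlet_character_def)
  qed simp
  from this[of "n mod k" "n div k"] show ?thesis
    by simp
qed

text \<open>By periodicity \<open>chi\<close> takes finitely many values, while the powers of a
  value of modulus above 1 would be unbounded.\<close>

lemma norm_dirichlet_character_le_1:
  assumes "dirichlet_character k chi"
  shows "norm (chi n) \<le> 1"
proof (rule ccontr)
  assume "\<not> norm (chi n) \<le> 1"
  then have gt: "norm (chi n) > 1" by simp
  have k: "k > 0"
    using assms by (simp add: dirichlet_character_def)
  \<comment> \<open>The exponent \<open>Suc j\<close> keeps the base case free of
    \<open>chi 1\<close>, whose value the definition does not state directly.\<close>
  have power: "chi (n ^ Suc j) = chi n ^ Suc j" for j
    using assms by (induction j) (simp_all add: dirichlet_character_def)
  define B where "B = Max ((norm \<circ> chi) ` {..<k})"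
  have "norm (chi m) \<le> B" for m
    unfolding B_def using k dirichlet_character_mod[OF assms, of m]
    by (intro Max_ge) (auto intro!: image_eqI[of _ _ "m mod k"])
  moreover obtain j where j: "B < norm (chi n) ^ j"
    using real_arch_pow[OF gt] by blast
  moreover have "norm (chi n) ^ j \<le> norm (chi n) ^ Suc j"
    using gt by (intro power_increasing) auto
  ultimately show False
    using power[of j] by (metis less_le_trans norm_power not_less)
qed

text \<open>Multiplication by some \<open>a\<close> coprime to \<open>k\<close> with
  \<open>chi a \<noteq> 1\<close> permutes the residues, so the sum equals \<open>chi a\<close>
  times itself.\<close>

lemma sum_dirichlet_character:
  assumes chi: "dirichlet_character k chi" and "chi \<noteq> principal_character k"
  shows "(\<Sum>n<k. chi n) = 0"
proof -
  have k: "k > 0" and mult: "\<And>m n. chi (m * n) = chi m * chi n"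
    and nz: "\<And>n. chi n \<noteq> 0 \<longleftrightarrow> coprime n k"
    using chi by (auto simp: dirichlet_character_def)
  \<comment> \<open>Both functions vanish off the residues coprime to \<open>k\<close>, so a point
    where they differ must be coprime to \<open>k\<close>.\<close>
  obtain a where "chi a \<noteq> principal_character k a"
    using assms(2) by blast
  then have a: "coprime a k" "chi a \<noteq> 1"
    using nz[of a] by (auto simp: principal_character_def split: if_splits)
  have inj: "inj_on (\<lambda>n. (a * n) mod k) {..<k}"
  proof (rule inj_onI)
    fix x y assume xy: "x \<in> {..<k}" "y \<in> {..<k}" "(a * x) mod k = (a * y) mod k"
    then have "[a * x = a * y] (mod k)"
      by (simp add: cong_def)
    then have "[x = y] (mod k)"
      using cong_mult_lcancel_nat[OF a(1)] by blast
    with xy show "x = y"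
      by (simp add: cong_def)
  qed
  have "(\<lambda>n. (a * n) mod k) ` {..<k} = {..<k}"
    using k by (intro card_subset_eq) (auto simp: card_image[OF inj])
  then have "(\<Sum>n<k. chi n) = (\<Sum>n<k. chi ((a * n) mod k))"
    using sum.reindex[OF inj, of chi] by simp
  also have "\<dots> = chi a * (\<Sum>n<k. chi n)"
    by (simp add: dirichlet_character_mod[OF chi] mult sum_distrib_left)
  finally show ?thesis
    using a(2) by simp
qed

text \<open>Complete periods contribute 0, which leaves fewer than \<open>k\<close> terms of modulus
  at most 1.\<close>

lemma norm_sum_dirichlet_character_le:
  assumes chi: "dirichlet_character k chi" and "chi \<noteq> principal_character k"
  shows "norm (\<Sum>n<N. chi n) \<le> real k"
proof (induction N rule: less_induct)
  case (less N)
  have k: "k > 0" and per: "\<And>n. chi (n + k) = chi n"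
    using chi by (auto simp: dirichlet_character_def)
  show ?case
  proof (cases "N < k")
    case True
    have "norm (\<Sum>n<N. chi n) \<le> (\<Sum>n<N. 1)"
      by (intro sum_norm_le norm_dirichlet_character_le_1[OF chi])
    with True show ?thesis
      by simp
  next
    case False
    then have "(\<Sum>n<N. chi n) = (\<Sum>n<k. chi n) + (\<Sum>n<N-k. chi (n + k))"
      using sum.atLeastLessThan_concat[of 0 k N chi]
        sum.shift_bounds_nat_ivl[of chi 0 k "N - k"]
      by (simp add: atLeast0LessThan)
    then have "(\<Sum>n<N. chi n) = (\<Sum>n<N-k. chi n)"
      by (simp add: sum_dirichlet_character[OF assms] per)
    with less.IH[of "N - k"] k False show ?thesis
      by simp
  qed
qed

section \<open>The random set and its mean\<close>

text \<open>The value 0 below 3 matches \<open>pseudo_primes\<close>, so sums may start at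
  0.\<close>

definition pseudo_prime_prob :: "nat \<Rightarrow> real" where
  "pseudo_prime_prob n = (if n \<ge> 3 then 1 / ln (real n) else 0)"

lemma one_le_ln:
  assumes "n \<ge> 3"
  shows "1 \<le> ln (real n)"
  using assms exp_le by (subst ln_ge_iff) auto

text \<open>Non-principality enters here, through the bounded partial sums of \<open>chi\<close>.
  The index is shifted by 3 because \<open>pseudo_prime_prob\<close> decreases only from 3
  on.\<close>

lemma summable_character_pseudo_prime_prob:
  assumes "dirichlet_character k chi" and "chi \<noteq> principal_character k"
  shows "summable (\<lambda>n. chi n * of_real (pseudo_prime_prob n))"
proof -
  have "summable (\<lambda>n. chi (n + 3) * of_real (1 / ln (real (n + 3))))"
  proof (rule Dirichlet_test)
    show "norm (\<Sum>i<n. chi (i + 3)) \<le> 2 * real k" for n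
    proof -
      have "(\<Sum>i<n. chi (i + 3)) = (\<Sum>i<n+3. chi i) - (\<Sum>i<3. chi i)"
        by (induction n) (simp_all add: algebra_simps numeral_eq_Suc)
      also have "norm \<dots> \<le> real k + real k"
        using norm_sum_dirichlet_character_le[OF assms]
        by (intro norm_triangle_le_diff add_mono)
      finally show ?thesis
        by simp
    qed
    show "decseq (\<lambda>n. 1 / ln (real (n + 3)))"
      by (intro decseq_SucI) (auto intro!: divide_left_mono mult_pos_pos)
    show "(\<lambda>n. 1 / ln (real (n + 3))) \<longlonglongrightarrow> 0"
      by real_asymp
  qed
  also have "(\<lambda>n. chi (n + 3) * of_real (1 / ln (real (n + 3))))
      = (\<lambda>n. chi (n + 3) * of_real (pseudo_prime_prob (n + 3)))"
    by (simp add: pseudo_prime_prob_def)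
  finally show ?thesis
    by (subst (asm) summable_iff_shift)
qed

lemma (in prob_space) expectation_uniform_le:
  fixes U :: "'a \<Rightarrow> real"
  assumes [measurable]: "random_variable borel U" and "distr M borel U = uniform_measure lborel {0..1}"
    and t: "0 \<le> t" "t \<le> 1"
  shows "expectation (\<lambda>\<omega>. indicat_real {..t} (U \<omega>)) = t"
proof -
  have "expectation (\<lambda>\<omega>. indicat_real {..t} (U \<omega>)) = integral\<^sup>L (distr M borel U) (indicator {..t})"
    by (rule integral_distr[symmetric]) measurable
  also have "\<dots> = measure (uniform_measure lborel {0..1}) {..t}"
    by (simp add: assms(2))
  also have "\<dots> = measure lborel ({0..1} \<inter> {..t})"
    by (subst measure_uniform_measure) auto
  also have "{0..1} \<inter> {..t} = {0..t}"
    using t by auto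
  finally show ?thesis
    using t by simp
qed

text \<open>Hoeffding bounds the probability of a deviation of size \<open>N powr \<theta>\<close>
  by a stretched exponential in \<open>N\<close>, which is summable because
  \<open>2 * \<theta> - 1 > 0\<close>. By Borel-Cantelli, almost surely only finitely many
  \<open>N\<close> are bad.\<close>

lemma (in prob_space) AE_pseudo_prime_deviation:
  fixes r :: "nat \<Rightarrow> 'a \<Rightarrow> real" and c :: "nat \<Rightarrow> real"
  assumes indep: "indep_vars (\<lambda>_. borel) r {3..}"
    and unif: "\<And>n. n \<ge> 3 \<Longrightarrow> distr M borel (r n) = uniform_measure lborel {0..1}"
    and c: "\<And>n. \<bar>c n\<bar> \<le> 1" and \<theta>: "\<theta> > 1 / 2"
  shows "AE \<omega> in M. (\<lambda>N. \<Sum>n<N. c n * (indicator (pseudo_primes r \<omega>) n - pseudo_prime_prob n))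
                      \<in> O(\<lambda>N. real N powr \<theta>)"
proof -
  have r: "random_variable borel (r n)" if "n \<ge> 3" for n
    using indep that by (auto simp: indep_vars_def)
  define X where "X n \<omega> = c n * indicator {..1 / ln (real n)} (r n \<omega>)" for n \<omega>
  have indepX: "indep_vars (\<lambda>_. borel) X {3..}"
    unfolding X_def by (rule indep_vars_compose2[OF indep]) auto
  have EX: "expectation (X n) = c n * pseudo_prime_prob n" if "n \<ge> 3" for n
    unfolding X_def using that one_le_ln[OF that]
    by (simp add: expectation_uniform_le[OF r[OF that] unif[OF that]] pseudo_prime_prob_def)
  define A where "A N = {\<omega> \<in> space M. real N powr \<theta> \<le>
      \<bar>(\<Sum>n\<in>{3..<N}. X n \<omega>) - (\<Sum>n\<in>{3..<N}. expectation (X n))\<bar>}" for N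
  have X: "random_variable borel (X n)" if "n \<ge> 3" for n
    using indepX that by (auto simp: indep_vars_def)
  have meas: "A N \<in> sets M" for N
    unfolding A_def
    by (intro borel_measurable_le borel_measurable_const borel_measurable_abs borel_measurable_diff
        borel_measurable_sum X) auto
  \<comment> \<open>From \<open>N = 4\<close> on the range of summation is nonempty, so Hoeffding's
    denominator is positive.\<close>
  have prob: "prob (A N) \<le> 2 * exp (- (real N powr (2 * \<theta> - 1) / 2))" if N: "N \<ge> 4" for N
  proof -
    interpret Hoeffding_ineq M "{3..<N}" X "\<lambda>_. -1" "\<lambda>_. 1" "\<Sum>n\<in>{3..<N}. expectation (X n)"
    proof unfold_locales
      show "indep_vars (\<lambda>_. borel) X {3..<N}"
        by (rule indep_vars_subset[OF indepX]) auto
      show "AE x in M. X i x \<in> {-1..1}" for i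
        using c[of i] by (intro AE_I2) (auto simp: X_def indicator_def abs_le_iff)
    qed simp_all
    \<comment> \<open>The denominator \<open>4 * (real N - 3)\<close> is enlarged to
      \<open>4 * real N\<close>, which turns the exponent into a single power of
      \<open>N\<close>.\<close>
    have "real N powr (2 * \<theta> - 1) / 2 = 2 * (real N powr \<theta>)\<^sup>2 / (4 * real N)"
      using N by (simp add: powr_diff power2_eq_square flip: powr_add)
    also have "\<dots> \<le> 2 * (real N powr \<theta>)\<^sup>2 / (4 * (real N - 3))"
      using N by (intro divide_left_mono) auto
    finally have le: "- 2 * (real N powr \<theta>)\<^sup>2 / (4 * (real N - 3)) \<le> - (real N powr (2 * \<theta> - 1) / 2)"
      by simp
    have "prob (A N) \<le> 2 * exp (- 2 * (real N powr \<theta>)\<^sup>2 / (\<Sum>i\<in>{3..<N}. (1 - (-1))\<^sup>2))"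
      unfolding A_def by (rule Hoeffding_ineq_abs_ge) (use N in auto)
    also have "(\<Sum>i\<in>{3..<N}. (1 - (-1 :: real))\<^sup>2) = 4 * (real N - 3)"
      using N by simp
    finally show ?thesis
      using le by (smt (verit) exp_le_cancel_iff)
  qed
  have "summable (\<lambda>N. prob (A N))"
  proof (rule summable_comparison_test'[where N = 4])
    have "(\<lambda>N. 2 * exp (- (real N powr (2 * \<theta> - 1) / 2))) \<in> O(\<lambda>N. real N powr (-2))"
      using \<theta> by real_asymp
    then show "summable (\<lambda>N. 2 * exp (- (real N powr (2 * \<theta> - 1) / 2)))"
      by (rule summable_comparison_test_bigo[rotated]) (simp add: summable_real_powr_iff)
  qed (use prob in simp)
  then have "AE \<omega> in M. eventually (\<lambda>N. \<omega> \<in> space M - A N) sequentially"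
    using meas by (intro borel_cantelli_AE1) (auto simp: emeasure_eq_measure)
  then show ?thesis
  proof eventually_elim
    case (elim \<omega>)
    show ?case
    proof (rule bigoI[where c = 1], rule eventually_mono[OF elim])
      fix N assume N: "\<omega> \<in> space M - A N"
      have "(\<Sum>n<N. c n * (indicator (pseudo_primes r \<omega>) n - pseudo_prime_prob n))
          = (\<Sum>n\<in>{3..<N}. c n * (indicator (pseudo_primes r \<omega>) n - pseudo_prime_prob n))"
        by (rule sum.mono_neutral_right) (auto simp: pseudo_primes_def pseudo_prime_prob_def)
      also have "\<dots> = (\<Sum>n\<in>{3..<N}. X n \<omega> - expectation (X n))"
        by (rule sum.cong) (auto simp: EX, auto simp: X_def pseudo_primes_def indicator_def algebra_simps)
      finally show "norm (\<Sum>n<N. c n * (indicator (pseudo_primes r \<omega>) n - pseudo_prime_prob n))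
          \<le> 1 * norm (real N powr \<theta>)"
        using N by (auto simp: A_def sum_subtractf)
    qed
  qed
qed

section \<open>Infinitude of the random set\<close>

text \<open>Each term with \<open>3 \<le> n < N\<close> is at least \<open>1 / ln N\<close>, so the
  sum is at least \<open>(N - 3) / ln N\<close>, which outgrows \<open>N powr (3/4)\<close>.\<close>

lemma sum_pseudo_prime_prob_not_bigo:
  "(\<lambda>N. \<Sum>n<N. pseudo_prime_prob n) \<notin> O(\<lambda>N. real N powr (3/4))"
proof
  assume *: "(\<lambda>N. \<Sum>n<N. pseudo_prime_prob n) \<in> O(\<lambda>N. real N powr (3/4))"
  have le: "(real N - 3) / ln (real N) \<le> (\<Sum>n<N. pseudo_prime_prob n)" if N: "N \<ge> 4" for N
  proof -
    have "(real N - 3) / ln (real N) = (\<Sum>n\<in>{3..<N}. 1 / ln (real N))"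
      using N by simp
    also have "\<dots> \<le> (\<Sum>n\<in>{3..<N}. pseudo_prime_prob n)"
      by (intro sum_mono) (auto simp: pseudo_prime_prob_def intro!: divide_left_mono mult_pos_pos)
    also have "\<dots> \<le> (\<Sum>n<N. pseudo_prime_prob n)"
      by (intro sum_mono2) (auto simp: pseudo_prime_prob_def)
    finally show ?thesis .
  qed
  have "(\<lambda>N. (real N - 3) / ln (real N)) \<in> O(\<lambda>N. \<Sum>n<N. pseudo_prime_prob n)"
  proof (rule bigoI[where c = 1], rule eventually_mono[OF eventually_ge_at_top[of 4]])
    fix N :: nat assume "4 \<le> N"
    moreover from this have "0 \<le> (real N - 3) / ln (real N)"
      by simp
    ultimately show "norm ((real N - 3) / ln (real N)) \<le> 1 * norm (\<Sum>n<N. pseudo_prime_prob n)"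
      using le[of N] by simp
  qed
  also note *
  also have "(\<lambda>N. real N powr (3/4)) \<in> o(\<lambda>N. (real N - 3) / ln (real N))"
    by real_asymp
  \<comment> \<open>The chain puts a function into its own little-o class, which forces it to vanish
    eventually.\<close>
  finally have "\<forall>\<^sub>F N in sequentially. (real N - 3) / ln (real N) = 0"
    by (simp only: landau_o.small_refl_iff)
  moreover have "\<forall>\<^sub>F N in sequentially. (real N - 3) / ln (real N) > 0"
    by real_asymp
  ultimately have "\<forall>\<^sub>F N in sequentially. False"
    by eventually_elim (metis less_irrefl)
  then show False
    by simp
qed

text \<open>For finite \<open>P\<close> the counting function is bounded, so the deviation bound
  would pass to the mean.\<close>

lemma infinite_if_deviation:
  assumes "(\<lambda>N. \<Sum>n<N. indicator P n - pseudo_prime_prob n) \<in> O(\<lambda>N. real N powr (3/4))"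
  shows "infinite P"
proof
  assume "finite P"
  have "(\<lambda>N. \<Sum>n<N. indicator P n) \<in> O(\<lambda>_. 1 :: real)"
  proof (rule bigoI[where c = "real (card P)"], rule always_eventually, rule allI)
    fix N
    have "(\<Sum>n<N. indicator P n) = real (card ({..<N} \<inter> P))"
      by (simp add: indicator_def sum.If_cases Int_def)
    also have "\<dots> \<le> real (card P)"
      using \<open>finite P\<close> by (simp add: card_mono)
    finally show "norm (\<Sum>n<N. indicator P n :: real) \<le> real (card P) * norm (1::real)"
      by (simp add: sum_nonneg)
  qed
  also have "(\<lambda>_. 1 :: real) \<in> O(\<lambda>N. real N powr (3/4))"
    by real_asymp
  finally have "(\<lambda>N. \<Sum>n<N. indicator P n :: real) \<in> O(\<lambda>N. real N powr (3/4))" .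
  from sum_in_bigo(2)[OF this assms] have "(\<lambda>N. \<Sum>n<N. pseudo_prime_prob n) \<in> O(\<lambda>N. real N powr (3/4))"
    by (simp add: sum_subtractf)
  with sum_pseudo_prime_prob_not_bigo show False
    by blast
qed

section \<open>Character sums over the random set and the Euler product\<close>

text \<open>Write \<open>x\<close> as \<open>(x - m) + m\<close>: the first part is controlled by
  its real and imaginary parts, and the second has bounded partial sums, absorbed because
  \<open>\<theta> \<ge> 0\<close>.\<close>

lemma character_sum_bigo:
  fixes chi :: "nat \<Rightarrow> complex" and m x :: "nat \<Rightarrow> real"
  assumes m: "summable (\<lambda>n. chi n * of_real (m n))" and "\<theta> \<ge> 0"
    and Re: "(\<lambda>N. \<Sum>n<N. Re (chi n) * (x n - m n)) \<in> O(\<lambda>N. real N powr \<theta>)"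
    and Im: "(\<lambda>N. \<Sum>n<N. Im (chi n) * (x n - m n)) \<in> O(\<lambda>N. real N powr \<theta>)"
  shows "(\<lambda>N. norm (\<Sum>n<N. chi n * of_real (x n))) \<in> O(\<lambda>N. real N powr \<theta>)"
proof -
  let ?D = "\<lambda>N. \<Sum>n<N. chi n * of_real (x n - m n)"
  have "Bseq (\<lambda>N. \<Sum>n<N. chi n * of_real (m n))"
    using m by (intro convergent_imp_Bseq) (simp add: summable_iff_convergent)
  then obtain K where "\<And>N. norm (\<Sum>n<N. chi n * of_real (m n)) \<le> K"
    by (auto simp: Bseq_def)
  then have "(\<lambda>N. norm (\<Sum>n<N. chi n * of_real (m n))) \<in> O(\<lambda>_. 1 :: real)"
    by (intro bigoI[where c = K]) simp
  also have "(\<lambda>_. 1 :: real) \<in> O(\<lambda>N. real N powr \<theta>)"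
    using \<open>\<theta> \<ge> 0\<close> by (intro bigoI[where c = 1] eventually_mono[OF eventually_ge_at_top[of 1]])
      (simp add: ge_one_powr_ge_zero)
  finally have mean: "(\<lambda>N. norm (\<Sum>n<N. chi n * of_real (m n))) \<in> O(\<lambda>N. real N powr \<theta>)" .
  have "(\<lambda>N. \<bar>Re (?D N)\<bar> + \<bar>Im (?D N)\<bar>) \<in> O(\<lambda>N. real N powr \<theta>)"
    using Re Im by (intro sum_in_bigo) simp_all
  from sum_in_bigo(1)[OF this mean]
  have bound: "(\<lambda>N. \<bar>Re (?D N)\<bar> + \<bar>Im (?D N)\<bar> + norm (\<Sum>n<N. chi n * of_real (m n)))
      \<in> O(\<lambda>N. real N powr \<theta>)" .
  have "norm (\<Sum>n<N. chi n * of_real (x n))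
      \<le> \<bar>Re (?D N)\<bar> + \<bar>Im (?D N)\<bar> + norm (\<Sum>n<N. chi n * of_real (m n))" for N
  proof -
    have "(\<Sum>n<N. chi n * of_real (x n)) = ?D N + (\<Sum>n<N. chi n * of_real (m n))"
      by (simp add: algebra_simps flip: sum.distrib)
    then show ?thesis
      by (metis (no_types, lifting) add_right_mono cmod_le norm_triangle_le)
  qed
  then have "(\<lambda>N. norm (\<Sum>n<N. chi n * of_real (x n)))
      \<in> O(\<lambda>N. \<bar>Re (?D N)\<bar> + \<bar>Im (?D N)\<bar> + norm (\<Sum>n<N. chi n * of_real (m n)))"
    by (intro bigoI[where c = 1]) simp
  then show ?thesis
    using bound by (rule landau_o.big_trans)
qed

text \<open>Sums over \<open>P\<close> are treated as sums over all \<open>n\<close> with zero terms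
  off \<open>P\<close>. The enumeration is strictly increasing, so passing to it keeps the order of
  the terms, as conditional convergence demands.\<close>

lemma euler_product_converges:
  fixes chi :: "nat \<Rightarrow> complex"
  assumes P: "infinite P" "P \<subseteq> {3..}" and chi: "\<And>n. norm (chi n) \<le> 1"
    and S: "(\<lambda>N. norm (\<Sum>n<N. chi n * of_real (indicator P n))) \<in> O(\<lambda>N. real N powr \<theta>)"
    and \<theta>: "1 / 2 \<le> \<theta>" "\<theta> < Re s"
  shows "convergent_prod (euler_factor chi P s) \<and> random_L chi P s \<noteq> 0"
proof -
  define z where "z n = chi n * of_real (indicator P n) / of_nat n powr s" for n
  have z: "norm (z n) \<le> real n powr (- Re s)" for n
    using chi[of n] by (auto simp: z_def norm_mult norm_divide norm_powr_real_powr powr_minus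
        indicator_def divide_simps mult_left_le_one_le)
  define e where "e = enumerate P"
  have e: "strict_mono e" "range e = P"
    using P(1) by (simp_all add: e_def strict_mono_enumerate range_enumerate)
  have zero: "z n = 0" if "n \<notin> range e" for n
    using that e(2) by (simp add: z_def)
  have ze: "z (e i) = chi (enumerate P i) / of_nat (enumerate P i) powr s" for i
    using enumerate_in_set[OF P(1), of i] by (simp add: z_def e_def)
  \<comment> \<open>The largest possible modulus, since every element of \<open>P\<close> is at
    least 3.\<close>
  define q where "q = 3 powr (- Re s)"
  have "q < 3 powr 0"
    unfolding q_def using \<theta> by (intro powr_less_mono) auto
  then have q: "q < 1" by simp
  have ze_le: "norm (z (e i)) \<le> q" for i
  proof -
    have "e i \<in> P"
      using e(2) by blast
    then have "real (e i) powr (- Re s) \<le> q"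
      unfolding q_def using P(2) \<theta> by (intro powr_mono2') auto
    with z[of "e i"] show ?thesis
      by linarith
  qed
  have "summable z"
    unfolding z_def using S \<theta> by (intro summable_dirichlet_series) auto
  then have sum1: "summable (\<lambda>i. z (e i))"
    using summable_mono_reindex[OF e(1), of z] zero by simp
  have "summable (\<lambda>n. (norm (z n))\<^sup>2)"
  proof (rule summable_comparison_test'[where N = 0])
    show "summable (\<lambda>n. real n powr (- (2 * Re s)))"
      using \<theta> by (subst summable_real_powr_iff) simp
    show "norm ((norm (z n))\<^sup>2) \<le> real n powr (- (2 * Re s))" for n
      using power_mono[OF z[of n], of 2]
      by (simp add: power2_eq_square flip: powr_add)
  qed
  then have sum2: "summable (\<lambda>i. (norm (z (e i)))\<^sup>2)"
    using summable_mono_reindex[OF e(1), of "\<lambda>n. (norm (z n))\<^sup>2"] zero by simp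
  have factor: "euler_factor chi P s = (\<lambda>i. inverse (1 - z (e i)))"
    by (simp add: euler_factor_def ze fun_eq_iff)
  have "convergent_prod (\<lambda>i. inverse (1 - z (e i)))"
    using sum1 sum2 q ze_le by (rule convergent_prod_inverse_one_minus)
  \<comment> \<open>\<open>convergent_prod\<close> tolerates finitely many zero factors, so each
    factor has to be checked before the product can be declared nonzero.\<close>
  moreover have "inverse (1 - z (e i)) \<noteq> 0" for i
    using ze_le[of i] q by auto
  ultimately show ?thesis
    unfolding random_L_def factor using prodinf_nonzero by blast
qed

section \<open>One almost sure event for all \<open>s\<close>\<close>

theorem theorem3:
  fixes M :: "'a measure" and r :: "nat \<Rightarrow> 'a \<Rightarrow> real"
    and k :: nat and chi :: "nat \<Rightarrow> complex"
  assumes "prob_space M"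
    and "dirichlet_character k chi"
    and "chi \<noteq> principal_character k"
    and "prob_space.indep_vars M (\<lambda>_. borel) r {3..}"
    and "\<And>n. n \<ge> 3 \<Longrightarrow> distr M borel (r n) = uniform_measure lborel {0..1}"
  shows "AE \<omega> in M. \<forall>\<epsilon>>0. \<forall>s. Re s > 1 / 2 + \<epsilon> \<longrightarrow>
           convergent_prod (euler_factor chi (pseudo_primes r \<omega>) s) \<and>
           random_L chi (pseudo_primes r \<omega>) s \<noteq> 0"
proof -
  interpret prob_space M by fact
  have chi: "norm (chi n) \<le> 1" for n
    by (rule norm_dirichlet_character_le_1[OF assms(2)])
  let ?dev = "\<lambda>c \<omega> \<theta>. (\<lambda>N. \<Sum>n<N. c n * (indicator (pseudo_primes r \<omega>) n - pseudo_prime_prob n))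
      \<in> O(\<lambda>N. real N powr \<theta>)"
  have dev: "AE \<omega> in M. ?dev c \<omega> \<theta>" if "\<And>n. \<bar>c n\<bar> \<le> 1" "\<theta> > 1 / 2" for c :: "nat \<Rightarrow> real" and \<theta>
    by (rule AE_pseudo_prime_deviation) (use assms that in auto)
  have Re: "\<bar>Re (chi n)\<bar> \<le> 1" and Im: "\<bar>Im (chi n)\<bar> \<le> 1" for n
    using chi[of n] abs_Re_le_cmod[of "chi n"] abs_Im_le_cmod[of "chi n"] by linarith+
  \<comment> \<open>A sequence of exponents decreasing to 1/2: countably many almost sure events can
    be intersected, and the intersection serves all \<open>s\<close> and \<open>\<epsilon>\<close>
    at once.\<close>
  let ?\<theta> = "\<lambda>j. 1 / 2 + 1 / real (Suc j)"
  have "AE \<omega> in M. \<forall>j. ?dev (\<lambda>n. Re (chi n)) \<omega> (?\<theta> j)"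
    unfolding AE_all_countable by (intro allI dev Re) simp
  moreover have "AE \<omega> in M. \<forall>j. ?dev (\<lambda>n. Im (chi n)) \<omega> (?\<theta> j)"
    unfolding AE_all_countable by (intro allI dev Im) simp
  \<comment> \<open>The exponent 3/4 lies above 1/2, as the deviation bound requires, and below 1,
    so that the mean outgrows it.\<close>
  moreover have "AE \<omega> in M. ?dev (\<lambda>_. 1) \<omega> (3/4)"
    by (intro dev) auto
  ultimately show ?thesis
  proof eventually_elim
    case (elim \<omega>)
    let ?P = "pseudo_primes r \<omega>"
    have inf: "infinite ?P"
      using elim(3) by (intro infinite_if_deviation) simp
    show ?case
    proof (intro allI impI)
      fix \<epsilon> :: real and s :: complex
      assume "\<epsilon> > 0" "Re s > 1 / 2 + \<epsilon>"
      \<comment> \<open>This \<open>j\<close> gives \<open>?\<theta> j < Re s\<close>, the room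
        needed for partial summation.\<close>
      then obtain j where j: "1 / real (Suc j) < Re s - 1 / 2"
        using reals_Archimedean[of "Re s - 1 / 2"] by (auto simp: inverse_eq_divide)
      have "(\<lambda>N. norm (\<Sum>n<N. chi n * of_real (indicator ?P n))) \<in> O(\<lambda>N. real N powr ?\<theta> j)"
        using elim(1,2) by (intro character_sum_bigo[OF summable_character_pseudo_prime_prob[OF assms(2,3)]]) auto
      moreover have "?P \<subseteq> {3..}"
        by (auto simp: pseudo_primes_def)
      ultimately show "convergent_prod (euler_factor chi ?P s) \<and> random_L chi ?P s \<noteq> 0"
        using j by (intro euler_product_converges[OF inf _ chi]) auto
    qed
  qed
qed

end
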